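(* Let $p:\mathbb{R}^n\to\mathbb{R}$ be a hyperbolic polynomial of degree $d$ along $e\in\mathbb{R}^n$, with hyperbolicity cone $\Lambda=\Lambda(p,e)$. Suppose that $p$ is complete, isometric and that $\lambda(\mathbb{R}^n)=\mathbb{R}^d_{\downarrow}$ holds. Define $f:\mathbb{R}^d\to\mathbb{R}$ by $f(u)=\frac12\sum_{i=1}^d\max\{u_i,0\}^2$. Then $f\circ\lambda:\mathbb{R}^n\to\mathbb{R}$ is convex and differentiable, and for all $x\in\mathbb{R}^n$, $$P_\Lambda(x)=\nabla(f\circ\lambda)(x).$$
   Context: A homogeneous polynomial $p:\mathbb{R}^n\to\mathbb{R}$ of degree $d$ is hyperbolic along $e\in\mathbb{R}^n$ if $p(e)\neq 0$ and, for every $x\in\mathbb{R}^n$, the univariate polynomial $t\mapsto p(x-te)$ has only real roots. Its $d$ roots (with multiplicity), ordered decreasingly $\lambda_1(x)\ge\cdots\ge\lambda_d(x)$, are the eigenvalues of $x$, and $\lambda(x)=(\lambda_1(x),\dots,\lambda_d(x))\in\mathbb{R}^d_{\downarrow}$, where $\mathbb{R}^d_{\downarrow}=\{u\in\mathbb{R}^d\mid u_1\ge\cdots\ge u_d\}$. For $S\subseteq\mathbb{R}^n$, $\lambda(S)=\{\lambda(x)\mid x\in S\}$. The hyperbolicity cone is the closed convex cone $\Lambda(p,e)=\{x\in\mathbb{R}^n\mid\lambda_d(x)\ge 0\}$. $p$ is complete if $\{x\mid\lambda(x)=0\}=\{0\}$. $p$ is isometric if for all $y,z\in\mathbb{R}^n$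 there exists $x\in\mathbb{R}^n$ with $\lambda(x)=\lambda(z)$ and $\lambda(x+y)=\lambda(x)+\lambda(y)$. For complete $p$, $\mathbb{R}^n$ is equipped with the norm $\|x\|_p=\|\lambda(x)\|_2$ (where $\|\cdot\|_2$ is the Euclidean norm on $\mathbb{R}^d$), which is induced by the inner product $\langle x,y\rangle_p=\frac14\|x+y\|_p^2-\frac14\|x-y\|_p^2$. The projection is $P_\Lambda(x)=\operatorname{argmin}_{y\in\Lambda}\|x-y\|_p$, and gradients of functions on $\mathbb{R}^n$ are taken with respect to $\langle\cdot,\cdot\rangle_p$. *)

theory Defs
  imports "HOL-Analysis.Analysis" "HOL-Computational_Algebra.Polynomial"
begin

definition homogeneous_polynomial :: "nat \<Rightarrow> (real ^ 'n \<Rightarrow> real) \<Rightarrow> bool" where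
  "homogeneous_polynomial d p \<longleftrightarrow>
     (\<exists>c :: ('n \<Rightarrow> nat) \<Rightarrow> real. \<forall>x.
        p x = (\<Sum>\<alpha> | (\<Sum>i\<in>UNIV. \<alpha> i) = d. c \<alpha> * (\<Prod>i\<in>UNIV. (x $ i) ^ \<alpha> i)))"

text \<open>The univariate polynomial \<open>t \<mapsto> p (x - t e)\<close>; it exists and is unique whenever
  \<open>p\<close> is a polynomial function.\<close>

definition line_poly :: "(real ^ 'n \<Rightarrow> real) \<Rightarrow> real ^ 'n \<Rightarrow> real ^ 'n \<Rightarrow> real poly" where
  "line_poly p e x = (THE q. \<forall>t. poly q t = p (x - t *\<^sub>R e))"

definition only_real_roots :: "real poly \<Rightarrow> bool" where
  "only_real_roots q \<longleftrightarrow> (\<forall>z :: complex. poly (map_poly of_real q) z = 0 \<longrightarrow> z \<in> \<real>)"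

definition hyperbolic :: "nat \<Rightarrow> (real ^ 'n \<Rightarrow> real) \<Rightarrow> real ^ 'n \<Rightarrow> bool" where
  "hyperbolic d p e \<longleftrightarrow>
     homogeneous_polynomial d p \<and> p e \<noteq> 0 \<and> (\<forall>x. only_real_roots (line_poly p e x))"

definition eigenvalue_list :: "(real ^ 'n \<Rightarrow> real) \<Rightarrow> real ^ 'n \<Rightarrow> real ^ 'n \<Rightarrow> real list" where
  "eigenvalue_list p e x = rev (sorted_list_of_multiset (proots (line_poly p e x)))"

text \<open>Coordinates of \<open>\<real>\<^sup>d\<close> are indexed by a finite linearly ordered type with \<open>d\<close> elements,
  so that the \<open>k\<close>-th smallest index carries the \<open>k\<close>-th largest root. The definition is only
  meaningful if \<open>p\<close> is hyperbolic of degree \<open>CARD('d)\<close>: then the list has exactly that length.\<close>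

definition eigenvalue_map ::
    "(real ^ 'n \<Rightarrow> real) \<Rightarrow> real ^ 'n \<Rightarrow> real ^ 'n \<Rightarrow> real ^ 'd::{finite,linorder}" where
  "eigenvalue_map p e x = (\<chi> i. eigenvalue_list p e x ! card {j. j < i})"

definition decreasing_vectors :: "(real ^ 'd::{finite,linorder}) set" where
  "decreasing_vectors = {u. \<forall>i j. i \<le> j \<longrightarrow> u $ j \<le> u $ i}"

text \<open>The following notions depend on \<open>(p, e)\<close> only through the eigenvalue map, which is
  passed as the argument \<open>lam\<close>.\<close>

definition hyp_cone :: "(real ^ 'n \<Rightarrow> real ^ 'd::{finite,linorder}) \<Rightarrow> (real ^ 'n) set" where
  "hyp_cone lam = {x. 0 \<le> lam x $ Max UNIV}"

definition hyp_complete :: "(real ^ 'n \<Rightarrow> real ^ 'd) \<Rightarrow> bool" where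
  "hyp_complete lam \<longleftrightarrow> {x. lam x = 0} = {0}"

definition hyp_isometric :: "(real ^ 'n \<Rightarrow> real ^ 'd) \<Rightarrow> bool" where
  "hyp_isometric lam \<longleftrightarrow> (\<forall>y z. \<exists>x. lam x = lam z \<and> lam (x + y) = lam x + lam y)"

definition hyp_norm :: "(real ^ 'n \<Rightarrow> real ^ 'd) \<Rightarrow> real ^ 'n \<Rightarrow> real" where
  "hyp_norm lam x = norm (lam x)"

definition hyp_inner :: "(real ^ 'n \<Rightarrow> real ^ 'd) \<Rightarrow> real ^ 'n \<Rightarrow> real ^ 'n \<Rightarrow> real" where
  "hyp_inner lam x y = 1/4 * (hyp_norm lam (x + y))\<^sup>2 - 1/4 * (hyp_norm lam (x - y))\<^sup>2"

definition is_hyp_projection ::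
    "(real ^ 'n \<Rightarrow> real ^ 'd::{finite,linorder}) \<Rightarrow> real ^ 'n \<Rightarrow> real ^ 'n \<Rightarrow> bool" where
  "is_hyp_projection lam x = is_arg_min (\<lambda>y. hyp_norm lam (x - y)) (\<lambda>y. y \<in> hyp_cone lam)"

definition hyp_projection ::
    "(real ^ 'n \<Rightarrow> real ^ 'd::{finite,linorder}) \<Rightarrow> real ^ 'n \<Rightarrow> real ^ 'n" where
  "hyp_projection lam x = (THE y. is_hyp_projection lam x y)"

definition is_hyp_gradient ::
    "(real ^ 'n \<Rightarrow> real ^ 'd) \<Rightarrow> (real ^ 'n \<Rightarrow> real) \<Rightarrow> real ^ 'n \<Rightarrow> real ^ 'n \<Rightarrow> bool" where
  "is_hyp_gradient lam F x g \<longleftrightarrow> (F has_derivative (\<lambda>h. hyp_inner lam g h)) (at x)"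

definition hyp_gradient ::
    "(real ^ 'n \<Rightarrow> real ^ 'd) \<Rightarrow> (real ^ 'n \<Rightarrow> real) \<Rightarrow> real ^ 'n \<Rightarrow> real ^ 'n" where
  "hyp_gradient lam F x = (THE g. is_hyp_gradient lam F x g)"

end

theory Submission
  imports Defs "HOL-Computational_Algebra.Fundamental_Theorem_Algebra" "HOL-Real_Asymp.Real_Asymp"
begin

text \<open>The squared norm \<open>\<parallel>\<lambda>(x)\<parallel>\<^sup>2\<close> is a quadratic form, because it can be read off from the coefficients
  of order one and two of \<open>r \<mapsto> p (e + r x)\<close>. The crucial step is that \<open>\<lambda>(x) \<le> \<lambda>(x + y)\<close> componentwise for
  \<open>y \<in> \<Lambda>\<close>. It gives convexity of \<open>\<Lambda>\<close> and the lower bound \<open>\<Sum> min {\<lambda>\<^sub>i(x), 0}\<^sup>2\<close> for the squared distance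
  of \<open>x\<close> to \<open>\<Lambda>\<close>. Isometry, applied to \<open>x\<close> and to a point with eigenvalues \<open>max {\<lambda>\<^sub>i(x), 0}\<close>, shows
  that this bound is attained. Hence \<open>f \<circ> \<lambda>\<close> is half the difference of the squared norm and the squared
  distance to \<open>\<Lambda>\<close>, which is a maximum of affine functions over \<open>\<Lambda>\<close> with gradient \<open>P\<^sub>\<Lambda>\<close>.\<close>

section \<open>Polynomials on lines and their lowest coefficients\<close>

lemma coeff_mult_top:
  fixes p q :: "'a::comm_semiring_0 poly"
  assumes "degree p \<le> m" "degree q \<le> n"
  shows "coeff (p * q) (m + n) = coeff p m * coeff q n"
proof -
  have "coeff p i * coeff q (m + n - i) = 0" if "i \<in> {..m+n} - {m}" for i
    using that assms by (cases "i < m") (auto simp: coeff_eq_0)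
  then have "coeff (p * q) (m + n) = (\<Sum>i\<in>{m}. coeff p i * coeff q (m + n - i))"
    unfolding coeff_mult by (intro sum.mono_neutral_right) auto
  then show ?thesis by simp
qed

lemma
  fixes a b :: "'a::comm_ring_1"
  shows degree_linear_power_le: "degree ([:a, b:] ^ k) \<le> k"
    and coeff_linear_power_top: "coeff ([:a, b:] ^ k) k = b ^ k"
proof -
  show 1: "degree ([:a, b:] ^ k) \<le> k" for k
    using degree_power_le[of "[:a, b:]" k] by (auto split: if_splits)
  show "coeff ([:a, b:] ^ k) k = b ^ k"
  proof (induction k)
    case (Suc k)
    then show ?case
      using coeff_mult_top[of "[:a, b:]" 1 "[:a, b:] ^ k" k] 1[of k] by simp
  qed simp
qed

lemma
  fixes z w :: "'n \<Rightarrow> 'a::comm_ring_1"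
  assumes "finite A"
  shows degree_prod_linear_power_le: "degree (\<Prod>i\<in>A. [:z i, w i:] ^ \<alpha> i) \<le> sum \<alpha> A"
    and coeff_prod_linear_power_top:
      "coeff (\<Prod>i\<in>A. [:z i, w i:] ^ \<alpha> i) (sum \<alpha> A) = (\<Prod>i\<in>A. w i ^ \<alpha> i)"
  using assms
proof (induction A)
  case (insert j A)
  { case 1
    show ?case using insert degree_linear_power_le[of "z j" "w j" "\<alpha> j"]
      by (auto intro!: order.trans[OF degree_mult_le] add_mono)
  next
    case 2
    show ?case using insert degree_linear_power_le[of "z j" "w j" "\<alpha> j"]
      by (simp add: coeff_mult_top coeff_linear_power_top)
  }
qed auto

text \<open>The restriction of a form to the line \<open>z + t w\<close>, as a polynomial in
  \<open>t\<close>. The ring stays open because the form is also evaluated at complex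
  points.\<close>

definition form_line :: "(('n::finite \<Rightarrow> nat) \<Rightarrow> 'a) \<Rightarrow> nat \<Rightarrow> ('n \<Rightarrow> 'a) \<Rightarrow> ('n \<Rightarrow> 'a) \<Rightarrow> 'a::idom poly"
  where "form_line c d z w =
    (\<Sum>\<alpha> | (\<Sum>i\<in>UNIV. \<alpha> i) = d. smult (c \<alpha>) (\<Prod>i\<in>UNIV. [:z i, w i:] ^ \<alpha> i))"

lemma poly_form_line:
  "poly (form_line c d z w) t =
    (\<Sum>\<alpha> | (\<Sum>i\<in>UNIV. \<alpha> i) = d. c \<alpha> * (\<Prod>i\<in>UNIV. (z i + t * w i) ^ \<alpha> i))"
  by (simp add: form_line_def poly_sum poly_prod)

lemma degree_form_line_le:
  fixes c :: "('a::finite \<Rightarrow> nat) \<Rightarrow> 'b::idom"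
  shows "degree (form_line c d z w) \<le> d"
\<comment> \<open>A sum over an infinite set is 0 by convention, so the case split spares a proof of
  finiteness.\<close>
proof (cases "finite {\<alpha> :: 'a \<Rightarrow> nat. (\<Sum>i\<in>UNIV. \<alpha> i) = d}")
  case True
  have "degree (\<Prod>i\<in>UNIV. [:z i, w i:] ^ \<alpha> i) \<le> sum \<alpha> UNIV" for \<alpha>
    by (rule degree_prod_linear_power_le) simp
  then show ?thesis unfolding form_line_def
    using True by (intro degree_sum_le) (auto intro: order.trans[OF degree_smult_le])
qed (simp add: form_line_def)

lemma coeff_form_line_top:
  "coeff (form_line c d z w) d = (\<Sum>\<alpha> | (\<Sum>i\<in>UNIV. \<alpha> i) = d. c \<alpha> * (\<Prod>i\<in>UNIV. w i ^ \<alpha> i))"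
  unfolding form_line_def coeff_sum
  by (intro sum.cong) (auto simp: coeff_prod_linear_power_top)

section \<open>Jets of order two\<close>

text \<open>Models the expansion at \<open>r = 0\<close> of a function of \<open>r x\<close>. The
  property survives sums and products, hence passes to \<open>form_line\<close>. Only the diagonal
  of \<open>b\<close> matters, so \<open>b\<close> need not be symmetric.\<close>

definition quadratic_jet :: "('v::real_vector \<Rightarrow> real poly) \<Rightarrow> bool"
  where "quadratic_jet P \<longleftrightarrow> (\<exists>a. \<forall>x. coeff (P x) 0 = a) \<and> linear (\<lambda>x. coeff (P x) 1) \<and>
    (\<exists>b. bilinear b \<and> (\<forall>x. coeff (P x) 2 = b x x))"

lemma bilinear_zero: "bilinear (\<lambda>x y. 0)"
  by (auto simp: bilinear_def intro!: linearI)

lemma bilinear_add: "bilinear f \<Longrightarrow> bilinear g \<Longrightarrow> bilinear (\<lambda>x y. f x y + g x y)"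
  by (auto simp: bilinear_def intro!: linear_compose_add)

lemma bilinear_cmult:
  fixes f :: "'a::real_vector \<Rightarrow> 'b::real_vector \<Rightarrow> real"
  shows "bilinear f \<Longrightarrow> bilinear (\<lambda>x y. c * f x y)"
  by (auto simp: bilinear_def linear_iff algebra_simps)

lemma bilinear_mult:
  fixes f g :: "'a::real_vector \<Rightarrow> real"
  shows "linear f \<Longrightarrow> linear g \<Longrightarrow> bilinear (\<lambda>x y. f x * g y)"
  by (auto simp: bilinear_def linear_iff algebra_simps)

lemma quadratic_jet_const: "quadratic_jet (\<lambda>x. [:a:])"
  using bilinear_zero
  by (auto simp: quadratic_jet_def coeff_pCons numeral_2_eq_2 intro!: exI[of _ "\<lambda>x y. 0"] linearI)

lemma quadratic_jet_linear: "linear f \<Longrightarrow> quadratic_jet (\<lambda>x. [:a, f x:])"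
  using bilinear_zero
  by (auto simp: quadratic_jet_def coeff_pCons numeral_2_eq_2 intro!: exI[of _ "\<lambda>x y. 0"])

lemma quadratic_jet_add:
  assumes "quadratic_jet P" "quadratic_jet Q"
  shows "quadratic_jet (\<lambda>x. P x + Q x)"
proof -
  obtain b b' where "bilinear b" "bilinear b'" "\<forall>x. coeff (P x) 2 = b x x"
    "\<forall>x. coeff (Q x) 2 = b' x x"
    using assms unfolding quadratic_jet_def by blast
  then show ?thesis
    using assms unfolding quadratic_jet_def
    by (auto intro!: linear_compose_add exI[of _ "\<lambda>x y. b x y + b' x y"] bilinear_add)
qed

lemma quadratic_jet_mult:
  assumes "quadratic_jet P" "quadratic_jet Q"
  shows "quadratic_jet (\<lambda>x. P x * Q x)"
proof -
  obtain b b' u v where b: "bilinear b" "bilinear b'" "\<And>x. coeff (P x) 2 = b x x"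
    "\<And>x. coeff (Q x) 2 = b' x x" "\<And>x. coeff (P x) 0 = u" "\<And>x. coeff (Q x) 0 = v"
    using assms unfolding quadratic_jet_def by blast
  have l: "linear (\<lambda>x. coeff (P x) (Suc 0))" "linear (\<lambda>x. coeff (Q x) (Suc 0))"
    using assms unfolding quadratic_jet_def by auto
  have c1: "coeff (P x * Q x) 1 = u * coeff (Q x) 1 + v * coeff (P x) 1" for x
    by (simp add: coeff_mult b atMost_Suc)
  have c2: "coeff (P x * Q x) 2 = u * b' x x + coeff (P x) 1 * coeff (Q x) 1 + v * b x x" for x
    using b(3)[of x] b(4)[of x] by (simp add: coeff_mult b atMost_Suc numeral_2_eq_2)
  have "bilinear (\<lambda>x y. u * b' x y + coeff (P x) 1 * coeff (Q y) 1 + v * b x y)"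
    using l by (intro bilinear_add bilinear_cmult bilinear_mult b) auto
  moreover have "linear (\<lambda>x. coeff (P x * Q x) 1)"
    unfolding c1 using l by (auto simp: linear_iff algebra_simps)
  moreover have "coeff (P x * Q x) 0 = u * v" for x
    by (simp add: coeff_mult b)
  ultimately show ?thesis
    unfolding quadratic_jet_def c2
    by (auto intro!: exI[of _ "\<lambda>x y. u * b' x y + coeff (P x) 1 * coeff (Q y) 1 + v * b x y"])
qed

lemma quadratic_jet_power: "quadratic_jet P \<Longrightarrow> quadratic_jet (\<lambda>x. P x ^ k)"
  using quadratic_jet_const[of 1] by (induction k) (auto simp: quadratic_jet_mult one_pCons)

lemma quadratic_jet_prod: "(\<And>i. i \<in> A \<Longrightarrow> quadratic_jet (P i)) \<Longrightarrow> quadratic_jet (\<lambda>x. \<Prod>i\<in>A. P i x)"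
  using quadratic_jet_const[of 1]
  by (induction A rule: infinite_finite_induct) (auto simp: quadratic_jet_mult one_pCons)

lemma quadratic_jet_sum: "(\<And>i. i \<in> A \<Longrightarrow> quadratic_jet (P i)) \<Longrightarrow> quadratic_jet (\<lambda>x. \<Sum>i\<in>A. P i x)"
  using quadratic_jet_const[of 0]
  by (induction A rule: infinite_finite_induct) (auto simp: quadratic_jet_add)

lemma quadratic_jet_smult: "quadratic_jet P \<Longrightarrow> quadratic_jet (\<lambda>x. smult c (P x))"
  using quadratic_jet_mult[OF quadratic_jet_const[of c]] by auto

lemma quadratic_jet_form_line: "quadratic_jet (\<lambda>x. form_line c d z (\<lambda>i. x $ i))"
  unfolding form_line_def
  by (intro quadratic_jet_sum quadratic_jet_smult quadratic_jet_prod quadratic_jet_power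
      quadratic_jet_linear) (auto intro!: linearI)

text \<open>These coefficients are the elementary symmetric functions of \<open>u\<close>; Newton's
  identity for the second one recovers the sum of squares.\<close>

lemma
  fixes u :: "'d \<Rightarrow> real"
  assumes "finite A"
  shows coeff_prod_one_linear_0: "coeff (\<Prod>i\<in>A. [:1, u i:]) 0 = 1"
    and coeff_prod_one_linear_1: "coeff (\<Prod>i\<in>A. [:1, u i:]) 1 = (\<Sum>i\<in>A. u i)"
    and coeff_prod_one_linear_2:
      "2 * coeff (\<Prod>i\<in>A. [:1, u i:]) 2 = (\<Sum>i\<in>A. u i)\<^sup>2 - (\<Sum>i\<in>A. (u i)\<^sup>2)"
  using assms
proof (induction A)
  case (insert j A)
  { case 1 show ?case using insert by simp
  next
    case 2 show ?case using insert by simp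
  next
    case 3
    have "coeff (\<Prod>i\<in>insert j A. [:1, u i:]) 2
        = coeff (\<Prod>i\<in>A. [:1, u i:]) 2 + u j * coeff (\<Prod>i\<in>A. [:1, u i:]) 1"
      using insert(1,2) by (simp add: numeral_2_eq_2)
    then show ?case using insert(2-5) insert(1)
      by (simp add: power2_sum algebra_simps)
  }
qed (auto simp: numeral_2_eq_2)

section \<open>Polynomial identities and real-rooted polynomials\<close>

lemma poly_eqI_infinite:
  fixes p q :: "'a::idom poly"
  assumes "infinite S" "\<And>t. t \<in> S \<Longrightarrow> poly p t = poly q t"
  shows "p = q"
proof -
  have "S \<subseteq> {t. poly (p - q) t = 0}"
    using assms(2) by auto
  then have "infinite {t. poly (p - q) t = 0}"
    using assms(1) infinite_super by blast
  then show ?thesis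
    using poly_roots_finite[of "p - q"] by auto
qed

lemma poly_eqI_cofinite:
  fixes p q :: "real poly"
  assumes "\<And>t. t \<noteq> 0 \<Longrightarrow> poly p t = poly q t"
  shows "p = q"
  by (rule poly_eqI_infinite[of "- {0}"]) (use assms in \<open>auto simp: finite_compl infinite_UNIV_char_0\<close>)

lemma map_poly_of_real_mult:
  "map_poly of_real (p * q) = (map_poly of_real p * map_poly of_real q :: complex poly)"
  by (rule poly_eqI) (simp add: coeff_map_poly coeff_mult)

lemma poly_map_poly_of_real:
  "poly (map_poly of_real q) (of_real r :: complex) = of_real (poly q r)"
  by (induction q) (auto simp: map_poly_pCons)

text \<open>Induction on the degree: the fundamental theorem of algebra gives a complex root, which
  is real by assumption, and its linear factor is split off.\<close>

lemma real_rooted_factorization: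
  fixes q :: "real poly"
  assumes "only_real_roots q" "q \<noteq> 0"
  shows "q = smult (lead_coeff q) (\<Prod>x\<in>#proots q. [:-x, 1:]) \<and> size (proots q) = degree q"
  using assms
proof (induction "degree q" arbitrary: q)
  case 0
  then obtain a where "q = [:a:]" by (metis degree_eq_zeroE)
  then show ?case using proots_const[of a] by simp
next
  case (Suc n)
  have "degree (map_poly complex_of_real q) > 0"
    using Suc(2) by (simp add: degree_map_poly)
  then obtain z where z: "poly (map_poly complex_of_real q) z = 0"
    using alg_closed_imp_poly_has_root by blast
  then obtain r where r: "z = of_real r"
    using Suc(3) unfolding only_real_roots_def Reals_def by auto
  have "poly q r = 0"
    using z unfolding r poly_map_poly_of_real by simp
  then obtain q' where q': "q = [:-r, 1:] * q'"
    by (auto simp: poly_eq_0_iff_dvd)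
  have nz: "q' \<noteq> 0" using Suc(4) q' by auto
  then have deg: "degree q' = n"
    using Suc(2) unfolding q' by (subst (asm) degree_mult_eq) auto
  have "poly (map_poly complex_of_real q) z = 0" if "poly (map_poly complex_of_real q') z = 0" for z
    using that unfolding q' map_poly_of_real_mult poly_mult by simp
  then have "only_real_roots q'"
    using Suc(3) unfolding only_real_roots_def by blast
  with Suc(1)[of q'] deg nz
  have IH: "q' = smult (lead_coeff q') (\<Prod>x\<in>#proots q'. [:-x, 1:])" "size (proots q') = n"
    by auto
  have pr: "proots q = add_mset r (proots q')"
    unfolding q' using nz by (subst proots_mult) auto
  have lc: "lead_coeff q = lead_coeff q'"
    unfolding q' by (subst lead_coeff_mult) auto
  have "q = smult (lead_coeff q') ([:-r, 1:] * (\<Prod>x\<in>#proots q'. [:-x, 1:]))"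
    unfolding mult_smult_right[symmetric] using q' IH(1) by metis
  then show ?case
    using IH(2) Suc(2) unfolding pr lc by simp
qed

section \<open>Eigenvalue maps\<close>

lemma power2_norm_vec: "(norm (u :: real ^ 'd))\<^sup>2 = (\<Sum>i\<in>UNIV. (u $ i)\<^sup>2)"
  by (simp add: norm_vec_def L2_set_def sum_nonneg)

lemma line_poly_eqI: "(\<And>t. poly q t = p (x - t *\<^sub>R e)) \<Longrightarrow> line_poly p e x = q"
  unfolding line_poly_def
  by (rule the_equality) (auto intro!: poly_eqI_cofinite)

section \<open>Ranks of indices and decreasing vectors\<close>

lemma rank_mono:
  fixes i j :: "'d::{finite,linorder}"
  shows "i \<le> j \<Longrightarrow> card {k. k < i} \<le> card {k. k < j}"
  by (intro card_mono) auto

lemma rank_strict_mono: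
  fixes i j :: "'d::{finite,linorder}"
  shows "i < j \<Longrightarrow> card {k. k < i} < card {k. k < j}"
  by (intro psubset_card_mono) auto

lemma bij_betw_rank:
  "bij_betw (\<lambda>i::'d::{finite,linorder}. card {k. k < i}) UNIV {..<CARD('d)}"
proof -
  have inj: "inj (\<lambda>i::'d. card {k. k < i})"
    by (rule linorder_injI) (metis rank_strict_mono less_irrefl)
  have "card {k. k < i} < CARD('d)" for i :: 'd
    by (intro psubset_card_mono) auto
  then have sub: "range (\<lambda>i::'d. card {k. k < i}) \<subseteq> {..<CARD('d)}"
    by auto
  have "range (\<lambda>i::'d. card {k. k < i}) = {..<CARD('d)}"
    using sub by (rule card_subset_eq[rotated]) (auto simp: card_image[OF inj])
  with inj show ?thesis by (simp add: bij_betw_def)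
qed

text \<open>The ranks run through each list position once. This turns the list of roots into the
  components of an eigenvalue vector without changing multiplicities.\<close>

lemma image_mset_nth_rank:
  fixes l :: "'a list"
  assumes "length l = CARD('d::{finite,linorder})"
  shows "image_mset (\<lambda>i::'d. l ! card {k. k < i}) (mset_set UNIV) = mset l"
proof -
  let ?r = "\<lambda>i::'d::{finite,linorder}. card {k. k < i}"
  have "image_mset (\<lambda>i. l ! ?r i) (mset_set UNIV) = image_mset ((!) l) (image_mset ?r (mset_set UNIV))"
    by (simp add: multiset.map_comp comp_def)
  also have "image_mset ?r (mset_set UNIV) = mset_set {..<CARD('d)}"
    using bij_betw_rank[where 'd='d] by (simp add: bij_betw_def image_mset_mset_set)
  also have "image_mset ((!) l) (mset_set {..<CARD('d)}) = mset (map ((!) l) [0..<length l])"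
    by (simp add: assms mset_map lessThan_atLeast0)
  finally show ?thesis by (simp add: map_nth)
qed

text \<open>The multiset determines how many components reach a level \<open>a\<close>. If
  \<open>u $ k\<close> exceeded \<open>v $ k\<close>, the level \<open>u $ k\<close> would be
  reached by all components of \<open>u\<close> up to \<open>k\<close>, but only by components of
  \<open>v\<close> before \<open>k\<close>.\<close>

lemma decreasing_vectors_eqI:
  fixes u v :: "real ^ 'd::{finite,linorder}"
  assumes u: "u \<in> decreasing_vectors" and v: "v \<in> decreasing_vectors"
    and eq: "image_mset (($) u) (mset_set UNIV) = image_mset (($) v) (mset_set UNIV)"
  shows "u = v"
proof -
  have card_eq: "card {i. u $ i \<ge> a} = card {i. v $ i \<ge> a}" for a
    using arg_cong[OF eq, of "\<lambda>M. size (filter_mset (\<lambda>x. x \<ge> a) M)"]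
    by (simp add: filter_mset_image_mset)
  have False if uv: "u' \<in> decreasing_vectors" "v' \<in> decreasing_vectors"
    "\<And>a. card {i. u' $ i \<ge> a} = card {i. v' $ i \<ge> a}" "u' $ k > v' $ k"
    for u' v' :: "real ^ 'd::{finite,linorder}" and k
  proof -
    have "{i. v' $ i \<ge> u' $ k} \<subseteq> {i. i < k}"
      using uv(2,4) unfolding decreasing_vectors_def
      by (auto simp: not_less[symmetric]) (meson leD leI less_le_trans)
    also have "{i. i < k} \<subset> {i. i \<le> k}" by auto
    also have "{i. i \<le> k} \<subseteq> {i. u' $ i \<ge> u' $ k}"
      using uv(1) unfolding decreasing_vectors_def by auto
    finally have "card {i. v' $ i \<ge> u' $ k} < card {i. u' $ i \<ge> u' $ k}"
      by (intro psubset_card_mono) auto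
    then show False using uv(3) by simp
  qed
  then have "\<not> u $ k > v $ k" "\<not> v $ k > u $ k" for k
    using u v card_eq by metis+
  then show ?thesis unfolding vec_eq_iff by (meson linorder_neqE)
qed

section \<open>The eigenvalue map of a hyperbolic polynomial\<close>

locale hyperbolic_eigenvalues =
  fixes p :: "real ^ 'n \<Rightarrow> real"
    and e :: "real ^ 'n"
    and lam :: "real ^ 'n \<Rightarrow> real ^ 'd::{finite,linorder}"
  assumes hyp: "hyperbolic CARD('d) p e"
    and lam: "lam = eigenvalue_map p e"
begin

definition monomial_coeff :: "('n \<Rightarrow> nat) \<Rightarrow> real" where
  "monomial_coeff = (SOME c. \<forall>x.
     p x = (\<Sum>\<alpha> | (\<Sum>i\<in>UNIV. \<alpha> i) = CARD('d). c \<alpha> * (\<Prod>i\<in>UNIV. (x $ i) ^ \<alpha> i)))"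

lemma p_expand:
  "p x = (\<Sum>\<alpha> | (\<Sum>i\<in>UNIV. \<alpha> i) = CARD('d). monomial_coeff \<alpha> * (\<Prod>i\<in>UNIV. (x $ i) ^ \<alpha> i))"
  using someI_ex[of "\<lambda>c. \<forall>x. p x = (\<Sum>\<alpha> | (\<Sum>i\<in>UNIV. \<alpha> i) = CARD('d). c \<alpha> * (\<Prod>i\<in>UNIV. (x $ i) ^ \<alpha> i))"] hyp
  unfolding hyperbolic_def homogeneous_polynomial_def monomial_coeff_def[symmetric] by blast

lemma p_homogeneous: "p (r *\<^sub>R x) = r ^ CARD('d) * p x"
  unfolding p_expand[of "r *\<^sub>R x"] p_expand[of x] sum_distrib_left
  by (intro sum.cong) (auto simp: power_mult_distrib prod.distrib simp flip: power_sum)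

lemma p_line: "p (x + t *\<^sub>R w) = poly (form_line monomial_coeff CARD('d) (($) x) (($) w)) t"
  unfolding poly_form_line by (simp add: p_expand)

text \<open>The leading coefficient shared by all polynomials
  \<open>line_poly p e x\<close>.\<close>

definition p_neg :: real where "p_neg = p (- e)"

lemma p_neg_nonzero: "p_neg \<noteq> 0"
  using p_homogeneous[of "-1" e] hyp by (simp add: p_neg_def hyperbolic_def)

lemma continuous_p: "continuous_on S p"
proof -
  have "continuous_on S (\<lambda>x. (\<Sum>\<alpha> | (\<Sum>i\<in>UNIV. \<alpha> i) = CARD('d).
      monomial_coeff \<alpha> * (\<Prod>i\<in>UNIV. (x $ i) ^ \<alpha> i)))"
    by (intro continuous_intros)
  then show ?thesis using p_expand by (metis (no_types, lifting) ext)
qed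

lemma line_poly:
  shows poly_line_poly: "poly (line_poly p e x) t = p (x - t *\<^sub>R e)"
    and degree_line_poly: "degree (line_poly p e x) = CARD('d)"
    and lead_coeff_line_poly: "lead_coeff (line_poly p e x) = p_neg"
proof -
  let ?q = "form_line monomial_coeff CARD('d) (($) x) (($) (- e))"
  have q: "poly ?q t = p (x - t *\<^sub>R e)" for t
    using p_line[of x t "- e"] by simp
  then have eq: "line_poly p e x = ?q"
    by (rule line_poly_eqI)
  show "poly (line_poly p e x) t = p (x - t *\<^sub>R e)"
    unfolding eq by (rule q)
  have c: "coeff ?q CARD('d) = p_neg"
    unfolding coeff_form_line_top p_neg_def by (rule p_expand[symmetric])
  then show "degree (line_poly p e x) = CARD('d)"
    unfolding eq using degree_form_line_le p_neg_nonzero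
    by (metis le_degree le_antisym)
  then show "lead_coeff (line_poly p e x) = p_neg"
    using c eq by simp
qed

lemma line_poly_nonzero: "line_poly p e x \<noteq> 0"
  using lead_coeff_line_poly[of x] p_neg_nonzero by auto

lemma line_poly_factorization:
  "line_poly p e x = smult p_neg (\<Prod>r\<in>#proots (line_poly p e x). [:-r, 1:])"
  "size (proots (line_poly p e x)) = CARD('d)"
proof -
  have "only_real_roots (line_poly p e x)"
    using hyp by (simp add: hyperbolic_def)
  from real_rooted_factorization[OF this line_poly_nonzero]
  show "line_poly p e x = smult p_neg (\<Prod>r\<in>#proots (line_poly p e x). [:-r, 1:])"
    "size (proots (line_poly p e x)) = CARD('d)"
    unfolding lead_coeff_line_poly unfolding degree_line_poly by blast+
qed

lemma length_eigenvalue_list: "length (eigenvalue_list p e x) = CARD('d)"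
  using line_poly_factorization(2)[of x]
  by (simp add: eigenvalue_list_def flip: size_mset)

lemma proots_line_poly: "proots (line_poly p e x) = image_mset (($) (lam x)) (mset_set UNIV)"
proof -
  have "($) (lam x) = (\<lambda>i. eigenvalue_list p e x ! card {k. k < i})"
    by (simp add: lam eigenvalue_map_def fun_eq_iff)
  then show ?thesis
    using image_mset_nth_rank[OF length_eigenvalue_list[of x]]
    by (simp add: eigenvalue_list_def)
qed

lemma lam_decreasing: "lam x \<in> decreasing_vectors"
proof -
  have "sorted (rev (eigenvalue_list p e x))"
    by (simp add: eigenvalue_list_def)
  moreover have "card {k. k < j} < length (eigenvalue_list p e x)" for j :: 'd
    using bij_betw_rank[where 'd='d] unfolding length_eigenvalue_list bij_betw_def by blast
  ultimately show ?thesis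
    unfolding decreasing_vectors_def lam eigenvalue_map_def
    by (auto intro!: sorted_rev_nth_mono rank_mono)
qed

lemma p_eigen: "p (x - t *\<^sub>R e) = p_neg * (\<Prod>i\<in>UNIV. t - lam x $ i)"
proof -
  have "poly (line_poly p e x) t = p_neg * (\<Prod>r\<in>#proots (line_poly p e x). t - r)"
    by (subst line_poly_factorization) (simp add: poly_prod_mset image_mset.compositionality comp_def)
  then show ?thesis
    unfolding poly_line_poly proots_line_poly
    by (simp add: multiset.map_comp comp_def prod_unfold_prod_mset)
qed

text \<open>The factorization fixes the multiset of roots, and the decreasing order fixes their
  positions.\<close>

lemma lam_eqI:
  assumes u: "u \<in> decreasing_vectors"
    and eq: "\<And>t. t \<noteq> 0 \<Longrightarrow> p (x - t *\<^sub>R e) = p_neg * (\<Prod>i\<in>UNIV. t - u $ i)"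
  shows "lam x = u"
proof -
  have "line_poly p e x = smult p_neg (\<Prod>i\<in>UNIV. [:- u $ i, 1:])"
    by (rule poly_eqI_cofinite) (simp add: eq poly_line_poly poly_prod)
  then have "proots (line_poly p e x) = proots (\<Prod>i\<in>UNIV. [:- u $ i, 1:])"
    using p_neg_nonzero by simp
  also have "\<dots> = image_mset (($) u) (mset_set UNIV)"
    by (subst proots_prod) (simp_all add: sum_unfold_sum_mset)
  finally show ?thesis
    using u lam_decreasing decreasing_vectors_eqI unfolding proots_line_poly by metis
qed

lemma lam_antimono: "i \<le> j \<Longrightarrow> lam x $ j \<le> lam x $ i"
  using lam_decreasing by (auto simp: decreasing_vectors_def)

lemma lam_scale:
  assumes "r > 0"
  shows "lam (r *\<^sub>R x) = r *\<^sub>R lam x"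
proof (rule lam_eqI)
  show "r *\<^sub>R lam x \<in> decreasing_vectors"
    using assms lam_decreasing[of x] by (auto simp: decreasing_vectors_def)
  fix t :: real
  have "p (r *\<^sub>R x - t *\<^sub>R e) = p (r *\<^sub>R (x - (t / r) *\<^sub>R e))"
    using assms by (simp add: algebra_simps)
  also have "\<dots> = p_neg * (\<Prod>i\<in>UNIV. r * (t / r - lam x $ i))"
    unfolding p_homogeneous p_eigen by (simp add: prod.distrib)
  also have "(\<Prod>i\<in>UNIV. r * (t / r - lam x $ i)) = (\<Prod>i\<in>UNIV. t - (r *\<^sub>R lam x) $ i)"
    using assms by (intro prod.cong) (auto simp: field_simps)
  finally show "p (r *\<^sub>R x - t *\<^sub>R e) = p_neg * (\<Prod>i\<in>UNIV. t - (r *\<^sub>R lam x) $ i)" .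
qed

lemma lam_shift: "lam (x + s *\<^sub>R e) = (\<chi> i. lam x $ i + s)"
proof (rule lam_eqI)
  show "(\<chi> i. lam x $ i + s) \<in> decreasing_vectors"
    using lam_decreasing[of x] by (auto simp: decreasing_vectors_def)
  fix t :: real
  have "p (x + s *\<^sub>R e - t *\<^sub>R e) = p (x - (t - s) *\<^sub>R e)"
    by (simp add: algebra_simps)
  then show "p (x + s *\<^sub>R e - t *\<^sub>R e) = p_neg * (\<Prod>i\<in>UNIV. t - (\<chi> i. lam x $ i + s) $ i)"
    using p_eigen[of x "t - s"] by (simp add: algebra_simps)
qed

text \<open>By homogeneity a root \<open>t\<close> for \<open>- x\<close> is a root
  \<open>- t\<close> for \<open>x\<close>. This suffices to see that \<open>- x\<close> has negative
  eigenvalues when \<open>x\<close> has positive ones.\<close>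

lemma lam_uminus: "\<exists>j. lam (- x) $ i = - (lam x $ j)"
proof -
  have "(\<Prod>j\<in>UNIV. lam (- x) $ i - lam (- x) $ j) = 0"
    by (rule prod_zero) (auto intro!: bexI[of _ i])
  then have "p (- x - lam (- x) $ i *\<^sub>R e) = 0"
    by (simp only: p_eigen[of "- x"] mult_zero_right)
  moreover define y where "y = x - (- lam (- x) $ i) *\<^sub>R e"
  then have "- x - lam (- x) $ i *\<^sub>R e = (-1) *\<^sub>R y"
    by simp
  ultimately have "p y = 0"
    using p_homogeneous[of "-1" y] by (metis mult_eq_0_iff power_eq_0_iff zero_neq_neg_one)
  then obtain j where "- lam (- x) $ i - lam x $ j = 0"
    unfolding y_def p_eigen[of x] using p_neg_nonzero by auto
  then have "lam (- x) $ i = - (lam x $ j)" by linarith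
  then show ?thesis ..
qed

text \<open>Since \<open>p (e + t x)\<close> is \<open>p e\<close> times the product of the factors
  \<open>1 + t * lam x $ i\<close>, its jet contains the first two elementary symmetric functions of
  the eigenvalues.\<close>

lemma norm_lam_quadratic: "\<exists>b. bilinear b \<and> (\<forall>x. (norm (lam x))\<^sup>2 = b x x)"
proof -
  define Q where "Q x = form_line monomial_coeff CARD('d) (($) e) (($) x)" for x
  have Q: "Q x = smult (p e) (\<Prod>i\<in>UNIV. [:1, lam x $ i:])" for x
  proof (rule poly_eqI_cofinite)
    fix t :: real assume t: "t \<noteq> 0"
    \<comment> \<open>For nonzero \<open>t\<close>, the point \<open>e + t x\<close> is
      \<open>t\<close> times a point on the line through \<open>x\<close> in direction
      \<open>e\<close>.\<close>
    have "poly (Q x) t = p (t *\<^sub>R (x - (- 1 / t) *\<^sub>R e))"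
      using t by (simp add: Q_def p_line[symmetric] algebra_simps)
    also have "\<dots> = p_neg * (\<Prod>i\<in>UNIV. t * (- 1 / t - lam x $ i))"
      unfolding p_homogeneous p_eigen by (simp add: prod.distrib)
    also have "(\<Prod>i\<in>UNIV. t * (- 1 / t - lam x $ i)) = (\<Prod>i\<in>UNIV. (- 1) * (1 + t * lam x $ i))"
      using t by (intro prod.cong) (auto simp: field_simps)
    also have "p_neg = (-1) ^ CARD('d) * p e"
      using p_homogeneous[of "-1" e] by (simp add: p_neg_def)
    finally show "poly (Q x) t = poly (smult (p e) (\<Prod>i\<in>UNIV. [:1, lam x $ i:])) t"
      by (simp only: prod.distrib prod_constant card_UNIV) (simp add: poly_prod power_mult_distrib[symmetric])
  qed
  have jet: "quadratic_jet (\<lambda>x. smult (1 / p e) (Q x))"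
    unfolding Q_def by (intro quadratic_jet_smult quadratic_jet_form_line)
  have q: "smult (1 / p e) (Q x) = (\<Prod>i\<in>UNIV. [:1, lam x $ i:])" for x
    using hyp by (simp add: Q hyperbolic_def)
  define f where "f x = (\<Sum>i\<in>UNIV. lam x $ i)" for x
  obtain b where b: "bilinear b" "\<And>x. coeff (\<Prod>i\<in>UNIV. [:1, lam x $ i:]) 2 = b x x"
    and f: "linear f"
    using jet unfolding quadratic_jet_def q f_def coeff_prod_one_linear_1[OF finite_class.finite_UNIV]
    by blast
  have "(norm (lam x))\<^sup>2 = f x * f x + (- 2) * b x x" for x
    using coeff_prod_one_linear_2[of UNIV "\<lambda>i. lam x $ i"]
    unfolding b(2) power2_norm_vec f_def by (simp add: power2_eq_square)
  moreover have "bilinear (\<lambda>x y. f x * f y + (- 2) * b x y)"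
    using f b(1) by (intro bilinear_add bilinear_cmult bilinear_mult)
  ultimately show ?thesis by blast
qed

end

section \<open>Monotonicity of the argument along a pencil\<close>

lemma cis_arctan: "Complex 1 v = of_real (sqrt (1 + v\<^sup>2)) * cis (arctan v)"
  by (simp add: complex_eq_iff cos_arctan sin_arctan real_sqrt_eq_zero_cancel_iff add_nonneg_eq_0_iff)

text \<open>Factoring out \<open>- \<i> * y\<close> leaves \<open>1 + \<i> * (x / y)\<close>, whose
  argument is an arctangent and thus continuous in \<open>x\<close> for either sign of
  \<open>y\<close>.\<close>

lemma complex_minus_imaginary_polar:
  assumes "y \<noteq> 0"
  shows "\<exists>r>0. Complex x (- y) = (- \<i> * of_real y) * (of_real r * cis (arctan (x / y)))"
proof (intro exI conjI)
  show "sqrt (1 + (x / y)\<^sup>2) > 0"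
    by (simp add: add_pos_nonneg)
  have "Complex x (- y) = (- \<i> * of_real y) * Complex 1 (x / y)"
    using assms by (simp add: complex_eq_iff)
  then show "Complex x (- y) = (- \<i> * of_real y) * (of_real (sqrt (1 + (x / y)\<^sup>2)) * cis (arctan (x / y)))"
    unfolding cis_arctan .
qed

lemma prod_polar:
  assumes "finite A" "\<And>i. i \<in> A \<Longrightarrow> y i \<noteq> 0"
  shows "\<exists>r>0. (\<Prod>i\<in>A. Complex (x i) (- y i)) =
    (\<Prod>i\<in>A. - \<i> * of_real (y i)) * (of_real r * cis (\<Sum>i\<in>A. arctan (x i / y i)))"
  using assms
proof (induction A)
  case (insert j A)
  obtain r where r: "r > 0" "(\<Prod>i\<in>A. Complex (x i) (- y i)) =
    (\<Prod>i\<in>A. - \<i> * of_real (y i)) * (of_real r * cis (\<Sum>i\<in>A. arctan (x i / y i)))"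
    using insert by auto
  obtain r' where r': "r' > 0"
    "Complex (x j) (- y j) = (- \<i> * of_real (y j)) * (of_real r' * cis (arctan (x j / y j)))"
    using complex_minus_imaginary_polar insert by (metis insertI1)
  show ?case
    using insert(1,2) r r' by (intro exI[of _ "r' * r"]) (simp add: cis_mult[symmetric])
qed (auto intro!: exI[of _ 1])

text \<open>Distinct values of \<open>h\<close> differ by a nonzero multiple of 2 pi, and a
  continuous function on the line cannot jump.\<close>

lemma continuous_cis_constant_imp_constant:
  fixes h :: "real \<Rightarrow> real"
  assumes cont: "continuous_on UNIV h" and const: "\<And>s. cis (h s) = w"
  shows "\<exists>c. \<forall>s. h s = c"
proof -
  have "\<exists>e>0. \<forall>y. y \<in> UNIV \<and> h y \<noteq> h x \<longrightarrow> e \<le> norm (h y - h x)" for x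
  proof (intro exI[of _ 1] conjI allI impI)
    fix y assume y: "y \<in> UNIV \<and> h y \<noteq> h x"
    have "cis (h y - h x) = cis (h y) / cis (h x)"
      by (rule cis_divide[symmetric])
    also have "\<dots> = 1"
      using const[of x] const[of y] cis_neq_zero[of "h x"] by simp
    finally have "cis (h y - h x) = 1" .
    from arg_cong[OF this, of Re] have "cos (h y - h x) = 1" by simp
    then obtain n :: int where n: "h y - h x = of_int n * (2 * pi)"
      unfolding cos_one_2pi_int by auto
    with y have "n \<noteq> 0" by auto
    then have "\<bar>real_of_int n\<bar> \<ge> 1" by linarith
    then have "\<bar>real_of_int n\<bar> * (2 * pi) \<ge> 1 * (2 * pi)"
      by (intro mult_right_mono) auto
    moreover have "norm (h y - h x) = \<bar>real_of_int n\<bar> * (2 * pi)"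
      unfolding n real_norm_def abs_mult by simp
    ultimately show "1 \<le> norm (h y - h x)"
      using pi_gt3 by linarith
  qed simp
  then have "h constant_on UNIV"
    using continuous_discrete_range_constant[OF connected_UNIV cont] by blast
  then show ?thesis by (auto simp: constant_on_def)
qed

text \<open>The components of \<open>T s\<close> are the real roots of a pencil at the parameter \<open>s\<close>, and \<open>R\<close> is the
  pencil at the complex level \<open>\<tau> + \<i>\<mu>\<close>, as a polynomial in \<open>s\<close>. Its roots are not real; comparing
  the total change of its argument with its degree forces them all into the upper half-plane, and then
  the argument increases with \<open>s\<close>.\<close>

lemma arctan_sum_mono:
  fixes T :: "real \<Rightarrow> real ^ 'd" and R :: "complex poly"
  assumes cont: "continuous_on UNIV T" and \<mu>: "\<mu> > 0" and k: "k \<noteq> 0"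
    and deg: "degree R \<le> CARD('d)"
    and eq: "\<And>s. poly R (of_real s) = k * (\<Prod>i\<in>UNIV. Complex (T s $ i - \<tau>) (- \<mu>))"
    and top: "\<And>i. filterlim (\<lambda>s. T s $ i) at_top at_top"
    and bot: "\<And>i. filterlim (\<lambda>s. T s $ i) at_bot at_bot"
    and le: "s \<le> s'"
  shows "(\<Sum>i\<in>UNIV. arctan ((T s $ i - \<tau>) / \<mu>)) \<le> (\<Sum>i\<in>UNIV. arctan ((T s' $ i - \<tau>) / \<mu>))"
proof -
  \<comment> \<open>Up to constants modulo 2 pi, \<open>\<Psi>\<close> is the argument of
    \<open>R\<close> on the real line read off from \<open>T\<close>, and \<open>\<Theta>\<close>
    below is the same argument read off from the roots of \<open>R\<close>.\<close>
  define \<Psi> where "\<Psi> s = (\<Sum>i\<in>UNIV. arctan ((T s $ i - \<tau>) / \<mu>))" for s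
  have Rnz: "poly R (of_real s) \<noteq> 0" for s
    unfolding eq using k \<mu> by (auto simp: Complex_eq_0)
  then have R0: "R \<noteq> 0" by auto
  obtain root where root: "smult (lead_coeff R) (\<Prod>j<degree R. [:- root j, 1:]) = R"
    using complex_poly_decompose' .
  define n where "n = degree R"
  define al where "al j = Re (root j)" for j
  define be where "be j = Im (root j)" for j
  have R: "poly R (of_real s) = lead_coeff R * (\<Prod>j<n. Complex (s - al j) (- be j))" for s
  proof -
    have "poly R (of_real s) = lead_coeff R * (\<Prod>j<n. of_real s - root j)"
      by (subst root[symmetric]) (simp add: poly_prod n_def)
    also have "(\<Prod>j<n. of_real s - root j) = (\<Prod>j<n. Complex (s - al j) (- be j))"
      by (intro prod.cong) (auto simp: al_def be_def complex_eq_iff)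
    finally show ?thesis .
  qed
  have be: "be j \<noteq> 0" if "j < n" for j
  proof
    assume "be j = 0"
    then have "poly R (of_real (al j)) = 0"
      unfolding R using that by (auto simp: Complex_eq_0 intro!: bexI[of _ j])
    with Rnz show False by blast
  qed
  define \<Theta> where "\<Theta> s = (\<Sum>j<n. arctan ((s - al j) / be j))" for s
  define a where "a = k * (\<Prod>i\<in>(UNIV::'d set). - \<i> * of_real \<mu>)"
  define b where "b = lead_coeff R * (\<Prod>j<n. - \<i> * of_real (be j))"
  have a: "a \<noteq> 0" using k \<mu> by (simp add: a_def)
  have b: "b \<noteq> 0" using be R0 by (auto simp: b_def)
  have cis_eq: "cis (\<Psi> s - \<Theta> s) = sgn (b / a)" for s
  proof -
    obtain r where r: "r > 0" "poly R (of_real s) = a * (of_real r * cis (\<Psi> s))"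
      using prod_polar[of "UNIV::'d set" "\<lambda>_. \<mu>" "\<lambda>i. T s $ i - \<tau>"] \<mu>
      unfolding eq \<Psi>_def a_def by auto
    obtain r' where r': "r' > 0" "poly R (of_real s) = b * (of_real r' * cis (\<Theta> s))"
      using prod_polar[of "{..<n}" be "\<lambda>j. s - al j"] be
      unfolding R \<Theta>_def b_def by auto
    have "b / a = of_real (r / r') * cis (\<Psi> s - \<Theta> s)"
      using r r' a b by (simp add: cis_divide[symmetric] field_simps)
    then show ?thesis
      using r(1) r'(1) by (simp add: sgn_mult sgn_of_real)
  qed
  have contT: "continuous_on UNIV (\<lambda>s. T s $ i)" for i
    using cont by (intro continuous_intros)
  have "continuous_on UNIV (\<lambda>s. \<Psi> s - \<Theta> s)"
    unfolding \<Psi>_def \<Theta>_def using \<mu> be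
    by (intro continuous_intros contT) auto
  then obtain c where c: "\<And>s. \<Psi> s - \<Theta> s = c"
    using continuous_cis_constant_imp_constant cis_eq by metis
  have \<Psi>top: "(\<Psi> \<longlongrightarrow> (\<Sum>i\<in>(UNIV::'d set). pi / 2)) at_top"
    unfolding \<Psi>_def
  proof (intro tendsto_sum filterlim_compose[OF tendsto_arctan_at_top])
    fix i
    have "filterlim (\<lambda>s. (1 / \<mu>) * (- \<tau> + T s $ i)) at_top at_top"
      using \<mu> top by (intro filterlim_tendsto_pos_mult_at_top[OF tendsto_const]
          filterlim_tendsto_add_at_top[OF tendsto_const]) auto
    then show "filterlim (\<lambda>s. (T s $ i - \<tau>) / \<mu>) at_top at_top"
      by (simp add: algebra_simps diff_divide_distrib)
  qed
  have \<Psi>bot: "(\<Psi> \<longlongrightarrow> (\<Sum>i\<in>(UNIV::'d set). - (pi / 2))) at_bot"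
    unfolding \<Psi>_def
  proof (intro tendsto_sum filterlim_compose[OF tendsto_arctan_at_bot])
    fix i
    have "filterlim (\<lambda>s. (1 / \<mu>) * (\<tau> + - (T s $ i))) at_top at_bot"
      using \<mu> bot[of i] unfolding filterlim_uminus_at_bot
      by (intro filterlim_tendsto_pos_mult_at_top[OF tendsto_const]
          filterlim_tendsto_add_at_top[OF tendsto_const]) auto
    then show "filterlim (\<lambda>s. (T s $ i - \<tau>) / \<mu>) at_bot at_bot"
      unfolding filterlim_uminus_at_bot by (simp add: algebra_simps diff_divide_distrib)
  qed
  have arctan_lim: "((\<lambda>s. arctan ((s - x) / y)) \<longlongrightarrow> sgn y * (pi / 2)) at_top"
    "((\<lambda>s. arctan ((s - x) / y)) \<longlongrightarrow> - (sgn y * (pi / 2))) at_bot" if "y \<noteq> 0" for x y :: real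
    using that by (cases "y > 0"; real_asymp)+
  have \<Theta>top: "(\<Theta> \<longlongrightarrow> (\<Sum>j<n. sgn (be j) * (pi / 2))) at_top"
    unfolding \<Theta>_def using be by (intro tendsto_sum arctan_lim) auto
  have \<Theta>bot: "(\<Theta> \<longlongrightarrow> (\<Sum>j<n. - (sgn (be j) * (pi / 2)))) at_bot"
    unfolding \<Theta>_def using be by (intro tendsto_sum arctan_lim) auto
  have "((\<lambda>s. \<Psi> s - \<Theta> s) \<longlongrightarrow> (\<Sum>i\<in>(UNIV::'d set). pi / 2) - (\<Sum>j<n. sgn (be j) * (pi / 2))) at_top"
    by (intro tendsto_diff \<Psi>top \<Theta>top)
  then have 1: "(\<Sum>i\<in>(UNIV::'d set). pi / 2) - (\<Sum>j<n. sgn (be j) * (pi / 2)) = c"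
    unfolding c by (auto simp: tendsto_const_iff)
  have "((\<lambda>s. \<Psi> s - \<Theta> s) \<longlongrightarrow> (\<Sum>i\<in>(UNIV::'d set). - (pi / 2)) - (\<Sum>j<n. - (sgn (be j) * (pi / 2)))) at_bot"
    by (intro tendsto_diff \<Psi>bot \<Theta>bot)
  then have 2: "(\<Sum>i\<in>(UNIV::'d set). - (pi / 2)) - (\<Sum>j<n. - (sgn (be j) * (pi / 2))) = c"
    unfolding c by (auto simp: tendsto_const_iff)
  \<comment> \<open>Over the whole line \<open>\<Psi>\<close> grows by pi for each component, while
    \<open>\<Theta>\<close> grows by pi times the sum of the signs of \<open>be\<close>.\<close>
  have "real CARD('d) * (pi / 2) = (\<Sum>j<n. sgn (be j)) * (pi / 2)"
    using 1 2 unfolding sum_negf sum_distrib_right[symmetric] sum_constant by linarith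
  then have sum_sgn: "real CARD('d) = (\<Sum>j<n. sgn (be j))"
    using pi_gt_zero by (simp only: mult_right_cancel)
  \<comment> \<open>The signs add up to \<open>CARD('d)\<close>, which is at least \<open>n\<close>;
    one negative sign would push the sum below \<open>n\<close>.\<close>
  have pos: "be j > 0" if "j < n" for j
  proof (rule ccontr)
    assume "\<not> be j > 0"
    then have "(\<Sum>j<n. sgn (be j)) < (\<Sum>j<n. 1)"
      using that by (intro sum_strict_mono_ex1) (auto simp: sgn_if intro!: bexI[of _ j])
    then show False
      using sum_sgn deg by (simp add: n_def)
  qed
  have "\<Theta> s \<le> \<Theta> s'"
    unfolding \<Theta>_def using le pos by (intro sum_mono) (auto simp: arctan_le_iff divide_right_mono less_imp_le)
  then show ?thesis
    using c[of s] c[of s'] unfolding \<Psi>_def by simp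
qed

section \<open>Monotonicity of the eigenvalues along the hyperbolicity cone\<close>

text \<open>As \<open>\<mu>\<close> tends to \<open>0\<close>, the sums count the components above the level \<open>\<tau>\<close> against those below it.\<close>

lemma le_if_arctan_sums_le:
  fixes u v :: "real ^ 'd::{finite,linorder}"
  assumes u: "u \<in> decreasing_vectors" and v: "v \<in> decreasing_vectors"
    and le: "\<And>\<tau> \<mu>. \<mu> > 0 \<Longrightarrow>
      (\<Sum>i\<in>UNIV. arctan ((u $ i - \<tau>) / \<mu>)) \<le> (\<Sum>i\<in>UNIV. arctan ((v $ i - \<tau>) / \<mu>))"
  shows "u $ k \<le> v $ k"
proof (rule ccontr)
  assume "\<not> u $ k \<le> v $ k"
  \<comment> \<open>The level \<open>\<tau>\<close> is the midpoint of \<open>v $ k\<close> and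
    \<open>u $ k\<close>. Hence \<open>u $ i\<close> is at least \<open>\<delta>\<close> above it
    for \<open>i \<le> k\<close>, and \<open>v $ i\<close> at least \<open>\<delta>\<close> below it
    for \<open>i \<ge> k\<close>.\<close>
  define \<delta> where "\<delta> = (u $ k - v $ k) / 2"
  define \<tau> where "\<tau> = (u $ k + v $ k) / 2"
  have \<delta>: "\<delta> > 0" using \<open>\<not> u $ k \<le> v $ k\<close> by (simp add: \<delta>_def)
  define n where "n = real (CARD('d) - 1)"
  have "filterlim (\<lambda>M. \<delta> * M) at_top at_top"
    using \<delta> by (intro filterlim_tendsto_pos_mult_at_top[OF tendsto_const]) (auto simp: filterlim_ident)
  note lim = filterlim_compose[OF tendsto_arctan_at_top this]
  \<comment> \<open>Here \<open>M\<close> plays the role of \<open>1 / \<mu>\<close>. The expression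
    will bound the difference of the two sums from below, and its limit is pi.\<close>
  have "((\<lambda>M. 2 * arctan (\<delta> * M) + n * (arctan (\<delta> * M) - pi / 2)) \<longlongrightarrow>
      2 * (pi / 2) + n * (pi / 2 - pi / 2)) at_top"
    by (intro tendsto_intros lim)
  then have "eventually (\<lambda>M. 2 * arctan (\<delta> * M) + n * (arctan (\<delta> * M) - pi / 2) > 0) at_top"
    by (rule order_tendstoD) simp
  then have "eventually (\<lambda>M. 2 * arctan (\<delta> * M) + n * (arctan (\<delta> * M) - pi / 2) > 0 \<and> M > 0) at_top"
    by (intro eventually_conj eventually_gt_at_top)
  then obtain M where M: "2 * arctan (\<delta> * M) + n * (arctan (\<delta> * M) - pi / 2) > 0" "M > 0"
    by (metis (no_types, lifting) eventually_happens trivial_limit_at_top_linorder)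
  define \<gamma> where "\<gamma> = arctan (\<delta> * M)"
  define A where "A i = arctan ((u $ i - \<tau>) * M)" for i
  define B where "B i = arctan ((v $ i - \<tau>) * M)" for i
  have A: "A i \<ge> \<gamma>" if "i \<le> k" for i
  proof -
    have "u $ i - \<tau> \<ge> \<delta>"
      using u that unfolding decreasing_vectors_def \<delta>_def \<tau>_def by (auto simp: field_simps)
    then show ?thesis
      unfolding A_def \<gamma>_def arctan_le_iff using M(2) by (intro mult_right_mono) auto
  qed
  have B: "B i \<le> - \<gamma>" if "i \<ge> k" for i
  proof -
    have "v $ i - \<tau> \<le> - \<delta>"
      using v that unfolding decreasing_vectors_def \<delta>_def \<tau>_def by (auto simp: field_simps)
    then have "(v $ i - \<tau>) * M \<le> (- \<delta>) * M"
      using M(2) by (intro mult_right_mono) auto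
    then show ?thesis
      unfolding B_def \<gamma>_def arctan_minus[symmetric] arctan_le_iff by simp
  qed
  have AB: "A i \<ge> - (pi / 2)" "B i \<le> pi / 2" for i
    using arctan_lbound arctan_ubound unfolding A_def B_def by (auto intro: less_imp_le)
  \<comment> \<open>Every index has one of the two bounds, and the other value is at worst pi/2 on
    the wrong side. The index \<open>k\<close> has both bounds and contributes
    \<open>2 * \<gamma>\<close>.\<close>
  have "A i - B i \<ge> \<gamma> - pi / 2" for i
    using A[of i] B[of i] AB[of i] linear[of i k] by (elim disjE) (simp_all add: algebra_simps)
  then have "(\<Sum>i\<in>UNIV - {k}. \<gamma> - pi / 2) \<le> (\<Sum>i\<in>UNIV - {k}. A i - B i)"
    by (intro sum_mono)
  then have "n * (\<gamma> - pi / 2) \<le> (\<Sum>i\<in>UNIV - {k}. A i - B i)"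
    by (simp add: n_def)
  moreover have "2 * \<gamma> \<le> A k - B k"
    using A[of k] B[of k] by simp
  ultimately have "2 * \<gamma> + n * (\<gamma> - pi / 2) \<le> (\<Sum>i\<in>UNIV. A i - B i)"
    using sum.remove[of UNIV k "\<lambda>i. A i - B i"] by simp
  then have "(\<Sum>i\<in>UNIV. A i) - (\<Sum>i\<in>UNIV. B i) > 0"
    using M(1) unfolding \<gamma>_def[symmetric] sum_subtractf by linarith
  then show False
    using le[of "1 / M" \<tau>] M(2) by (simp add: A_def B_def)
qed

section \<open>Continuity and monotonicity of the eigenvalue map\<close>

context hyperbolic_eigenvalues
begin

text \<open>Describes the graph of \<open>lam\<close> by conditions that are closed jointly in
  \<open>x\<close> and \<open>u\<close>.\<close>

lemma lam_eq_iff: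
  "lam x = u \<longleftrightarrow> u \<in> decreasing_vectors \<and> (\<forall>t. p (x - t *\<^sub>R e) = p_neg * (\<Prod>i\<in>UNIV. t - u $ i))"
  using lam_decreasing p_eigen lam_eqI by blast

lemma closed_lam_graph: "closed {z. lam (fst z) = snd z}"
proof -
  have cont: "continuous_on UNIV (\<lambda>z. p (fst z - t *\<^sub>R e))" for t
    by (rule continuous_on_compose2[OF continuous_p[of UNIV]]) (auto intro!: continuous_intros)
  show ?thesis
    unfolding lam_eq_iff decreasing_vectors_def mem_Collect_eq
    by (intro closed_Collect_conj closed_Collect_all closed_Collect_imp closed_Collect_le
        closed_Collect_eq continuous_intros cont open_Collect_const)
qed

text \<open>On a ball the quadratic form bounds the norm of \<open>lam\<close>, so the values stay
  in a compact set; a closed graph then forces continuity.\<close>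

lemma continuous_lam: "continuous_on S lam"
proof -
  obtain b where b: "bilinear b" "\<And>x. (norm (lam x))\<^sup>2 = b x x"
    using norm_lam_quadratic by blast
  obtain B where B: "\<And>x y. \<bar>b x y\<bar> \<le> B * norm x * norm y"
    using bilinear_bounded[OF b(1)] by auto
  have "isCont lam x" for x
  proof -
    define r where "r = norm x + 1"
    define T where "T = cball (0 :: real ^ 'd::{finite,linorder}) (sqrt (\<bar>B\<bar> * r * r))"
    have lamT: "lam y \<in> T" if "y \<in> cball 0 r" for y
    proof -
      have "(norm (lam y))\<^sup>2 \<le> B * norm y * norm y"
        using B[of y y] b(2)[of y] by linarith
      also have "\<dots> \<le> \<bar>B\<bar> * r * r"
        using that by (intro mult_mono) (auto simp: r_def)
      finally show ?thesis
        unfolding T_def by (simp add: real_le_rsqrt)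
    qed
    have "(\<lambda>y. (y, lam y)) ` cball 0 r = cball 0 r \<times> UNIV \<inter> {z. lam (fst z) = snd z}"
      by (auto simp: image_iff)
    then have "closed ((\<lambda>y. (y, lam y)) ` cball 0 r)"
      using closed_lam_graph by (auto intro!: closed_Int closed_Times)
    then have "continuous_on (cball 0 r) lam"
      using lamT by (intro continuous_from_closed_graph[of T]) (auto simp: T_def)
    then show ?thesis
      by (rule continuous_on_interior) (simp add: r_def)
  qed
  then show ?thesis
    by (simp add: continuous_at_imp_continuous_on)
qed

text \<open>The form at \<open>x + s a - \<zeta> e\<close> is a polynomial in \<open>s\<close> for
  fixed \<open>\<zeta>\<close>. For fixed real \<open>s\<close> it is a polynomial in
  \<open>\<zeta>\<close>, factored by the eigenvalues at real points and hence identically.\<close>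

lemma complex_pencil:
  "\<exists>R :: complex poly. degree R \<le> CARD('d) \<and>
    (\<forall>s. poly R (of_real s) = of_real p_neg * (\<Prod>i\<in>UNIV. \<zeta> - of_real (lam (x + s *\<^sub>R a) $ i)))"
proof (intro exI conjI allI)
  let ?c = "\<lambda>\<alpha>. complex_of_real (monomial_coeff \<alpha>)"
  let ?R = "form_line ?c CARD('d) (\<lambda>i. of_real (x $ i) - \<zeta> * of_real (e $ i)) (\<lambda>i. of_real (a $ i))"
  show "degree ?R \<le> CARD('d)"
    by (rule degree_form_line_le)
  fix s :: real
  let ?y = "x + s *\<^sub>R a"
  let ?L = "form_line ?c CARD('d) (\<lambda>i. of_real (?y $ i)) (\<lambda>i. - of_real (e $ i))"
  have "?L = smult (of_real p_neg) (\<Prod>i\<in>UNIV. [:- of_real (lam ?y $ i), 1:])"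
  proof (rule poly_eqI_infinite)
    show "infinite (range complex_of_real)"
      by (auto simp: finite_image_iff inj_def infinite_UNIV_char_0)
    fix z assume "z \<in> range complex_of_real"
    then obtain t where t: "z = of_real t" by auto
    have "poly ?L z = of_real (p (?y - t *\<^sub>R e))"
      unfolding t poly_form_line p_expand[of "?y - t *\<^sub>R e"] by simp
    then show "poly ?L z = poly (smult (of_real p_neg) (\<Prod>i\<in>UNIV. [:- of_real (lam ?y $ i), 1:])) z"
      unfolding p_eigen by (simp add: poly_prod t)
  qed
  moreover have "poly ?R (of_real s) = poly ?L \<zeta>"
    unfolding poly_form_line by (simp add: algebra_simps)
  ultimately show "poly ?R (of_real s) = of_real p_neg * (\<Prod>i\<in>UNIV. \<zeta> - of_real (lam ?y $ i))"
    by (simp add: poly_prod)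
qed

text \<open>Positivity of the eigenvalues of \<open>a\<close> sends all eigenvalues of
  \<open>x + s a\<close> to infinity in both directions of \<open>s\<close>, as
  \<open>arctan_sum_mono\<close> requires. The claim compares \<open>s = 0\<close> with
  \<open>s = 1\<close>.\<close>

lemma lam_mono_strict:
  assumes pos: "\<And>i. lam a $ i > 0"
  shows "lam x $ k \<le> lam (x + a) $ k"
proof -
  define T where "T s = lam (x + s *\<^sub>R a)" for s
  have cont: "continuous_on UNIV T"
    unfolding T_def by (rule continuous_on_compose2[OF continuous_lam[of UNIV]])
      (auto intro!: continuous_intros)
  have isC: "isCont (\<lambda>y. lam y $ i) z" for z i
    using continuous_lam[of UNIV] by (auto simp: continuous_on_eq_continuous_at intro!: continuous_intros)
  have top: "filterlim (\<lambda>s. T s $ i) at_top at_top" for i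
  proof -
    \<comment> \<open>By scaling, \<open>lam (x + s a)\<close> is \<open>s\<close> times
      \<open>lam (x / s + a)\<close>, and the latter tends to \<open>lam a\<close>.\<close>
    have "((\<lambda>s. (1 / s) *\<^sub>R x + a) \<longlongrightarrow> 0 *\<^sub>R x + a) at_top"
      by (intro tendsto_intros tendsto_divide_0[OF tendsto_const] filterlim_at_top_imp_at_infinity filterlim_ident)
    then have "((\<lambda>s. lam ((1 / s) *\<^sub>R x + a) $ i) \<longlongrightarrow> lam a $ i) at_top"
      using isCont_tendsto_compose[OF isC] by force
    then have "filterlim (\<lambda>s. lam ((1 / s) *\<^sub>R x + a) $ i * s) at_top at_top"
      using pos by (rule filterlim_tendsto_pos_mult_at_top) (rule filterlim_ident)
    moreover have "eventually (\<lambda>s. T s $ i = lam ((1 / s) *\<^sub>R x + a) $ i * s) at_top"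
      using eventually_gt_at_top[of 0]
    proof eventually_elim
      case (elim s)
      then show ?case
        using lam_scale[of s "(1 / s) *\<^sub>R x + a"] by (simp add: T_def scaleR_add_right)
    qed
    ultimately show ?thesis
      using filterlim_cong by fast
  qed
  have neg: "lam (- a) $ i < 0" for i
    using lam_uminus[of a i] pos by auto
  have "filterlim (\<lambda>s. T (- s) $ i) at_bot at_top" for i
  proof -
    have "((\<lambda>s. (1 / s) *\<^sub>R x - a) \<longlongrightarrow> 0 *\<^sub>R x - a) at_top"
      by (intro tendsto_intros tendsto_divide_0[OF tendsto_const] filterlim_at_top_imp_at_infinity filterlim_ident)
    then have "((\<lambda>s. lam ((1 / s) *\<^sub>R x - a) $ i) \<longlongrightarrow> lam (- a) $ i) at_top"
      using isCont_tendsto_compose[OF isC] by force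
    then have "filterlim (\<lambda>s. lam ((1 / s) *\<^sub>R x - a) $ i * s) at_bot at_top"
      using neg by (rule filterlim_tendsto_neg_mult_at_bot) (rule filterlim_ident)
    moreover have "eventually (\<lambda>s. T (- s) $ i = lam ((1 / s) *\<^sub>R x - a) $ i * s) at_top"
      using eventually_gt_at_top[of 0]
    proof eventually_elim
      case (elim s)
      then show ?case
        using lam_scale[of s "(1 / s) *\<^sub>R x - a"] by (simp add: T_def scaleR_diff_right)
    qed
    ultimately show ?thesis
      using filterlim_cong by fast
  qed
  then have bot: "filterlim (\<lambda>s. T s $ i) at_bot at_bot" for i
    unfolding filterlim_at_bot_mirror .
  have "(\<Sum>i\<in>UNIV. arctan ((T 0 $ i - \<tau>) / \<mu>)) \<le> (\<Sum>i\<in>UNIV. arctan ((T 1 $ i - \<tau>) / \<mu>))"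
    if \<mu>: "\<mu> > 0" for \<tau> \<mu>
  proof -
    obtain R :: "complex poly" where R: "degree R \<le> CARD('d)"
      "\<And>s. poly R (of_real s) = of_real p_neg * (\<Prod>i\<in>UNIV. Complex \<tau> \<mu> - of_real (T s $ i))"
      using complex_pencil[of "Complex \<tau> \<mu>" x a] unfolding T_def by blast
    have "(\<Prod>i\<in>UNIV. Complex \<tau> \<mu> - of_real (T s $ i))
        = (\<Prod>i\<in>(UNIV::'d set). - 1) * (\<Prod>i\<in>UNIV. Complex (T s $ i - \<tau>) (- \<mu>))" for s
      unfolding prod.distrib[symmetric] by (intro prod.cong) (auto simp: complex_eq_iff)
    then have "poly R (of_real s) = of_real p_neg * (\<Prod>i\<in>(UNIV::'d set). - 1) *
        (\<Prod>i\<in>UNIV. Complex (T s $ i - \<tau>) (- \<mu>))" for s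
      unfolding R(2) by (simp only: mult.assoc)
    from arctan_sum_mono[OF cont \<mu> _ R(1) this top bot] p_neg_nonzero
    show ?thesis by simp
  qed
  then have "T 0 $ k \<le> T 1 $ k"
    by (intro le_if_arctan_sums_le) (auto simp: T_def lam_decreasing)
  then show ?thesis by (simp add: T_def)
qed

text \<open>Adding \<open>\<epsilon> e\<close> makes the eigenvalues of \<open>y\<close> positive
  and shifts those of \<open>x + y\<close> by exactly \<open>\<epsilon>\<close>.\<close>

lemma lam_mono:
  assumes nonneg: "\<And>i. lam y $ i \<ge> 0"
  shows "lam x $ k \<le> lam (x + y) $ k"
proof (rule field_le_epsilon)
  fix \<epsilon> :: real assume "\<epsilon> > 0"
  then have "lam x $ k \<le> lam (x + (y + \<epsilon> *\<^sub>R e)) $ k"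
    using nonneg by (intro lam_mono_strict) (simp add: lam_shift add_nonneg_pos)
  then show "lam x $ k \<le> lam (x + y) $ k + \<epsilon>"
    using lam_shift[of "x + y" \<epsilon>] by (simp add: add.assoc)
qed

end

section \<open>Projections and Moreau envelopes\<close>

text \<open>The inner product is a parameter because the one induced by the eigenvalues is in
  general not that of the type. Minimizers are assumed; for the cone, isometry provides
  them.\<close>

locale inner_product_projection =
  fixes ip :: "'a::euclidean_space \<Rightarrow> 'a \<Rightarrow> real" and K :: "'a set" and P :: "'a \<Rightarrow> 'a"
  assumes ip: "bilinear ip" and sym: "ip x y = ip y x" and pos: "x \<noteq> 0 \<Longrightarrow> ip x x > 0"
    and K: "convex K" and P: "P x \<in> K"
    and P_min: "y \<in> K \<Longrightarrow> ip (x - P x) (x - P x) \<le> ip (x - y) (x - y)"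
begin

lemmas ip_simps = bilinear_ladd[OF ip] bilinear_radd[OF ip] bilinear_lsub[OF ip] bilinear_rsub[OF ip]
  bilinear_lmul[OF ip] bilinear_rmul[OF ip]

lemma nonneg: "ip x x \<ge> 0"
  using pos[of x] bilinear_lzero[OF ip] by (cases "x = 0") auto

text \<open>Compare \<open>u\<close> with the point at parameter \<open>\<theta>\<close> on the
  segment to \<open>y\<close>, for small \<open>\<theta>\<close>. Any minimizer \<open>u\<close> is
  allowed, which yields uniqueness afterwards.\<close>

lemma variational_inequality:
  assumes u: "u \<in> K" and min: "\<And>y. y \<in> K \<Longrightarrow> ip (x - u) (x - u) \<le> ip (x - y) (x - y)"
    and y: "y \<in> K"
  shows "ip (x - u) (y - u) \<le> 0"
proof (rule field_le_epsilon)
  fix \<epsilon> :: real assume \<epsilon>: "\<epsilon> > 0"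
  define n where "n = ip (y - u) (y - u)"
  define \<theta> where "\<theta> = min 1 (\<epsilon> / (n + 1))"
  have n: "n \<ge> 0" using nonneg by (simp add: n_def)
  have \<theta>: "\<theta> > 0" "\<theta> \<le> 1" using \<epsilon> n by (auto simp: \<theta>_def)
  have "(1 - \<theta>) *\<^sub>R u + \<theta> *\<^sub>R y \<in> K"
    using K u y \<theta> by (intro convexD) auto
  from min[OF this] have "2 * \<theta> * ip (x - u) (y - u) \<le> \<theta> * \<theta> * n"
    unfolding n_def by (simp add: ip_simps sym algebra_simps)
  then have "2 * ip (x - u) (y - u) \<le> \<theta> * n"
    using \<theta> by (simp add: mult.assoc mult.left_commute[of 2])
  also have "\<theta> * n \<le> \<epsilon> / (n + 1) * (n + 1)"
    using n \<theta> by (intro mult_mono) (auto simp: \<theta>_def)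
  finally show "ip (x - u) (y - u) \<le> 0 + \<epsilon>"
    using n \<epsilon> by simp
qed

lemma minimizer_unique:
  assumes u: "u \<in> K" and min: "\<And>y. y \<in> K \<Longrightarrow> ip (x - u) (x - u) \<le> ip (x - y) (x - y)"
  shows "u = P x"
proof -
  have "ip (x - u) (P x - u) \<le> 0" "ip (x - P x) (u - P x) \<le> 0"
    using variational_inequality[OF u min P] variational_inequality[OF P P_min u] by auto
  then have "ip (u - P x) (u - P x) \<le> 0"
    by (simp add: ip_simps sym algebra_simps)
  then show ?thesis
    using pos[of "u - P x"] by force
qed

text \<open>The convex conjugate of half the squared norm restricted to \<open>K\<close>: the
  maximum over \<open>y\<close> in \<open>K\<close> of \<open>ip x y - 1/2 * ip y y\<close>,
  attained at \<open>P x\<close>.\<close>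

definition envelope :: "'a \<Rightarrow> real" where
  "envelope x = 1/2 * (ip x x - ip (x - P x) (x - P x))"

lemma envelope_eq: "envelope x = ip x (P x) - 1/2 * ip (P x) (P x)"
  unfolding envelope_def by (simp add: ip_simps sym algebra_simps)

lemma envelope_ge: "y \<in> K \<Longrightarrow> ip x y - 1/2 * ip y y \<le> envelope x"
  using P_min[of y x] unfolding envelope_def by (simp add: ip_simps sym algebra_simps)

text \<open>The affine function that attains the maximum at the intermediate point lies below the
  envelope at both endpoints.\<close>

lemma convex_on_envelope: "convex_on UNIV envelope"
proof (rule convex_onI)
  fix t x y assume t: "0 < t" "t < (1::real)"
  define u where "u = P ((1 - t) *\<^sub>R x + t *\<^sub>R y)"
  have "envelope ((1 - t) *\<^sub>R x + t *\<^sub>R y)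
      = (1 - t) * (ip x u - 1/2 * ip u u) + t * (ip y u - 1/2 * ip u u)"
    unfolding envelope_eq u_def[symmetric] by (simp add: ip_simps field_simps)
  also have "\<dots> \<le> (1 - t) * envelope x + t * envelope y"
    using t envelope_ge[OF P] unfolding u_def by (intro add_mono mult_left_mono) auto
  finally show "envelope ((1 - t) *\<^sub>R x + t *\<^sub>R y) \<le> (1 - t) * envelope x + t * envelope y" .
qed simp

text \<open>Adding the variational inequalities at \<open>x\<close> and \<open>x + h\<close> gives
  firm nonexpansiveness, \<open>ip ?v ?v \<le> ip h ?v\<close>.\<close>

lemma ip_diff_projection_le: "ip h (P (x + h) - P x) \<le> ip h h"
proof -
  let ?v = "P (x + h) - P x"
  have "ip (x - P x) ?v \<le> 0" "ip (x + h - P (x + h)) (P x - P (x + h)) \<le> 0"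
    using variational_inequality[OF P P_min P] by auto
  then have "ip ?v ?v \<le> ip h ?v"
    by (simp add: ip_simps sym algebra_simps)
  moreover have "0 \<le> ip (?v - h) (?v - h)"
    by (rule nonneg)
  then have "2 * ip h ?v \<le> ip ?v ?v + ip h h"
    using sym[of ?v h] bilinear_lsub[OF ip, of ?v h "?v - h"] bilinear_rsub[OF ip, of _ ?v h] by simp
  ultimately show ?thesis by linarith
qed

text \<open>With \<open>h = y - x\<close>, the affine minorant touching at \<open>x\<close> makes
  the remainder nonnegative, and the one touching at \<open>y\<close> bounds it by
  \<open>ip h (P y - P x)\<close>, hence by \<open>ip h h\<close>.\<close>

lemma has_derivative_envelope: "(envelope has_derivative (\<lambda>h. ip (P x) h)) (at x)"
proof -
  obtain B where B: "B > 0" "\<And>x y. \<bar>ip x y\<bar> \<le> B * norm x * norm y"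
    using bilinear_bounded_pos[OF ip] by auto
  have lin: "bounded_linear (\<lambda>h. ip (P x) h)"
    using ip by (simp add: bilinear_def linear_conv_bounded_linear)
  have est: "norm (envelope y - envelope x - ip (P x) (y - x)) \<le> B * norm (y - x) * norm (y - x)" for y
  proof -
    define h where "h = y - x"
    have y: "y = x + h" by (simp add: h_def)
    have "0 \<le> envelope y - envelope x - ip (P x) h"
      using envelope_ge[OF P, of y x] envelope_eq[of x] unfolding y
      by (simp add: ip_simps sym algebra_simps)
    moreover have "envelope y - envelope x - ip (P x) h \<le> ip h (P y - P x)"
      using envelope_ge[OF P, of x y] envelope_eq[of y] unfolding y
      by (simp add: ip_simps sym algebra_simps)
    moreover have "ip h (P y - P x) \<le> ip h h"
      using ip_diff_projection_le unfolding y .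
    ultimately show ?thesis
      using B(2)[of h h] unfolding h_def[symmetric] by simp
  qed
  have "((\<lambda>y. norm (envelope y - envelope x - ip (P x) (y - x)) / norm (y - x)) \<longlongrightarrow> 0) (at x)"
  proof (rule tendsto_sandwich[of "\<lambda>_. 0" _ _ "\<lambda>y. B * norm (y - x)"])
    show "eventually (\<lambda>y. norm (envelope y - envelope x - ip (P x) (y - x)) / norm (y - x) \<le> B * norm (y - x)) (at x)"
      using est by (intro eventuallyI) (simp add: divide_le_eq)
    have "((\<lambda>y. B * norm (y - x)) \<longlongrightarrow> B * norm (x - x)) (at x)"
      by (intro tendsto_intros)
    then show "((\<lambda>y. B * norm (y - x)) \<longlongrightarrow> 0) (at x)" by simp
  qed (auto intro!: eventuallyI)
  then show ?thesis
    using lin by (simp add: has_derivative_iff_norm)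
qed

end

section \<open>Distance to the hyperbolicity cone\<close>

definition pos_part :: "real ^ 'd \<Rightarrow> real ^ 'd" where
  "pos_part u = (\<chi> i. max (u $ i) 0)"

context hyperbolic_eigenvalues
begin

lemma hyp_cone_iff: "x \<in> hyp_cone lam \<longleftrightarrow> (\<forall>i. lam x $ i \<ge> 0)"
  unfolding hyp_cone_def using lam_antimono[of _ "Max UNIV" x]
  by (auto intro: order_trans)

lemma convex_hyp_cone:
  assumes "hyp_complete lam"
  shows "convex (hyp_cone lam)"
proof -
  have zero: "lam 0 = 0"
    using assms by (auto simp: hyp_complete_def)
  have scale: "r *\<^sub>R x \<in> hyp_cone lam" if "r \<ge> 0" "x \<in> hyp_cone lam" for r x
    using that zero lam_scale[of r x] by (cases "r = 0") (auto simp: hyp_cone_iff)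
  have add: "x + y \<in> hyp_cone lam" if "x \<in> hyp_cone lam" "y \<in> hyp_cone lam" for x y
    using that lam_mono[of y x] by (auto simp: hyp_cone_iff intro: order_trans)
  show ?thesis
    by (intro convexI add scale) auto
qed

lemma
  shows hyp_inner_bilinear: "bilinear (hyp_inner lam)"
    and hyp_inner_sym: "hyp_inner lam x y = hyp_inner lam y x"
    and hyp_inner_self: "hyp_inner lam x x = (hyp_norm lam x)\<^sup>2"
    and hyp_norm_parallelogram:
      "(hyp_norm lam (x + y))\<^sup>2 + (hyp_norm lam (x - y))\<^sup>2
        = 2 * (hyp_norm lam x)\<^sup>2 + 2 * (hyp_norm lam y)\<^sup>2"
proof -
  obtain b where b: "bilinear b" "\<And>x. (hyp_norm lam x)\<^sup>2 = b x x"
    using norm_lam_quadratic unfolding hyp_norm_def by blast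
  note b_simps = bilinear_ladd[OF b(1)] bilinear_radd[OF b(1)] bilinear_lsub[OF b(1)]
    bilinear_rsub[OF b(1)] bilinear_lmul[OF b(1)] bilinear_rmul[OF b(1)]
  \<comment> \<open>Polarization returns the symmetric part of \<open>b\<close>.\<close>
  have eq: "hyp_inner lam x y = 1/2 * (b x y + b y x)" for x y
    unfolding hyp_inner_def b(2) by (simp add: b_simps algebra_simps)
  show "bilinear (hyp_inner lam)"
    unfolding bilinear_def linear_iff eq by (auto simp: b_simps algebra_simps)
  show "hyp_inner lam x y = hyp_inner lam y x"
    by (simp add: eq)
  show "hyp_inner lam x x = (hyp_norm lam x)\<^sup>2"
    by (simp add: eq b(2))
  show "(hyp_norm lam (x + y))\<^sup>2 + (hyp_norm lam (x - y))\<^sup>2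
      = 2 * (hyp_norm lam x)\<^sup>2 + 2 * (hyp_norm lam y)\<^sup>2"
    unfolding b(2) by (simp add: b_simps algebra_simps)
qed

text \<open>Subtracting \<open>y\<close> lowers every eigenvalue, so a negative one can only grow in
  absolute value; the other components contribute 0 to the bound.\<close>

lemma hyp_cone_distance_ge:
  assumes y: "y \<in> hyp_cone lam"
  shows "(norm (lam x - pos_part (lam x)))\<^sup>2 \<le> (hyp_norm lam (x - y))\<^sup>2"
  unfolding hyp_norm_def power2_norm_vec
proof (rule sum_mono)
  fix i
  have "lam (x - y) $ i \<le> lam x $ i"
    using lam_mono[of y "x - y" i] y by (simp add: hyp_cone_iff)
  then show "((lam x - pos_part (lam x)) $ i)\<^sup>2 \<le> (lam (x - y) $ i)\<^sup>2"
    by (cases "lam x $ i \<ge> 0") (auto simp: pos_part_def max_def abs_le_square_iff[symmetric])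
qed

text \<open>Isometry gives \<open>u\<close> with the eigenvalues \<open>pos_part (lam x)\<close> for
  which \<open>lam (u + x)\<close> is additive. The parallelogram law carries this from the sum to
  the difference \<open>x - u\<close>.\<close>

lemma hyp_cone_distance_attained:
  assumes isometric: "hyp_isometric lam" and range: "range lam = decreasing_vectors"
  shows "\<exists>u\<in>hyp_cone lam. (hyp_norm lam (x - u))\<^sup>2 = (norm (lam x - pos_part (lam x)))\<^sup>2"
proof -
  have "pos_part (lam x) \<in> decreasing_vectors"
    using lam_antimono by (auto simp: decreasing_vectors_def pos_part_def intro: max.coboundedI1)
  then obtain z where z: "lam z = pos_part (lam x)"
    using range by (metis imageE)
  obtain u where u: "lam u = pos_part (lam x)" "lam (u + x) = pos_part (lam x) + lam x"
    using isometric z unfolding hyp_isometric_def by metis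
  have "u \<in> hyp_cone lam"
    by (simp add: hyp_cone_iff u(1) pos_part_def)
  moreover have "(hyp_norm lam (x - u))\<^sup>2 = (norm (lam x - pos_part (lam x)))\<^sup>2"
    using hyp_norm_parallelogram[of u x] hyp_norm_parallelogram[of x u]
    unfolding hyp_norm_def add.commute[of x u] u power2_norm_eq_inner
    by (simp add: inner_simps inner_commute)
  ultimately show ?thesis by blast
qed

end

lemma has_derivative_hyp_inner_unique:
  assumes "bilinear (hyp_inner lam)" "\<And>x. x \<noteq> 0 \<Longrightarrow> hyp_inner lam x x > 0"
    and "is_hyp_gradient lam F x g" "is_hyp_gradient lam F x g'"
  shows "g = g'"
proof (rule ccontr)
  assume "g \<noteq> g'"
  then have "hyp_inner lam (g - g') (g - g') > 0"
    using assms(2) by simp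
  moreover have "hyp_inner lam g = hyp_inner lam g'"
    using has_derivative_unique assms(3,4) unfolding is_hyp_gradient_def by blast
  ultimately show False
    by (simp add: bilinear_lsub[OF assms(1)])
qed

theorem proposition3p6:
  fixes p :: "real ^ 'n \<Rightarrow> real"
    and e :: "real ^ 'n"
    and lam :: "real ^ 'n \<Rightarrow> real ^ 'd::{finite,linorder}"
    and f :: "real ^ 'd::{finite,linorder} \<Rightarrow> real"
  assumes hyp: "hyperbolic CARD('d) p e"
    and lam: "lam = eigenvalue_map p e"
    and complete: "hyp_complete lam"
    and isometric: "hyp_isometric lam"
    and range: "range lam = decreasing_vectors"
    and f: "\<And>u. f u = 1/2 * (\<Sum>i\<in>UNIV. (max (u $ i) 0)\<^sup>2)"
  shows "convex_on UNIV (f \<circ> lam) \<and>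
         (\<forall>x. (f \<circ> lam) differentiable (at x)) \<and>
         (\<forall>x. (\<exists>!y. is_hyp_projection lam x y) \<and>
              (\<exists>!g. is_hyp_gradient lam (f \<circ> lam) x g) \<and>
              hyp_projection lam x = hyp_gradient lam (f \<circ> lam) x)"
proof -
  interpret hyperbolic_eigenvalues p e lam
    using hyp lam by unfold_locales
  have "\<exists>P. \<forall>x. P x \<in> hyp_cone lam \<and> (hyp_norm lam (x - P x))\<^sup>2 = (norm (lam x - pos_part (lam x)))\<^sup>2"
    using hyp_cone_distance_attained[OF isometric range] by metis
  then obtain P where P_cone: "\<And>x. P x \<in> hyp_cone lam"
    and P_dist: "\<And>x. (hyp_norm lam (x - P x))\<^sup>2 = (norm (lam x - pos_part (lam x)))\<^sup>2"
    by blast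
  have pos: "hyp_inner lam x x > 0" if "x \<noteq> 0" for x
    using that complete by (auto simp: hyp_inner_self hyp_norm_def hyp_complete_def)
  \<comment> \<open>The lower bound \<open>hyp_cone_distance_ge\<close> is attained at
    \<open>P x\<close>, which is therefore a minimizer.\<close>
  interpret inner_product_projection "hyp_inner lam" "hyp_cone lam" P
    using hyp_inner_bilinear hyp_inner_sym pos convex_hyp_cone[OF complete] P_cone P_dist
      hyp_cone_distance_ge
    by unfold_locales (simp_all add: hyp_inner_self)
  \<comment> \<open>In each component the square of the positive part is the full square minus the
    square of the negative part.\<close>
  have F: "f \<circ> lam = envelope"
  proof
    fix x
    have "(\<Sum>i\<in>UNIV. (max (lam x $ i) 0)\<^sup>2)
        = (norm (lam x))\<^sup>2 - (norm (lam x - pos_part (lam x)))\<^sup>2"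
      unfolding power2_norm_vec sum_subtractf[symmetric]
      by (intro sum.cong) (auto simp: pos_part_def max_def)
    then show "(f \<circ> lam) x = envelope x"
      unfolding envelope_def hyp_inner_self P_dist by (simp add: f hyp_norm_def)
  qed
  have proj: "is_hyp_projection lam x y \<longleftrightarrow> y = P x" for x y
  proof -
    have "is_hyp_projection lam x y \<longleftrightarrow> y \<in> hyp_cone lam \<and>
        (\<forall>z\<in>hyp_cone lam. hyp_inner lam (x - y) (x - y) \<le> hyp_inner lam (x - z) (x - z))"
      unfolding is_hyp_projection_def is_arg_min_def hyp_inner_self
      by (auto simp: hyp_norm_def not_less)
    then show ?thesis
      using minimizer_unique P_cone P_min by blast
  qed
  have grad: "is_hyp_gradient lam (f \<circ> lam) x g \<longleftrightarrow> g = P x" for x g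
    using has_derivative_hyp_inner_unique[OF hyp_inner_bilinear pos] has_derivative_envelope
    unfolding F by (metis is_hyp_gradient_def)
  have "convex_on UNIV (f \<circ> lam)"
    unfolding F by (rule convex_on_envelope)
  moreover have "(f \<circ> lam) differentiable (at x)" for x
    unfolding F using has_derivative_envelope by (auto simp: differentiable_def)
  ultimately show ?thesis
    by (simp add: proj grad hyp_projection_def hyp_gradient_def)
qed

end
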